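(* Let $m,n,d\ge1$ be integers with $m>n$ and $m\ge n+d$. Let $A=A_0+A_1\mathbf{i}+A_2\mathbf{j}+A_3\mathbf{k}\in\mathbb{Q}_{\mathbb{R}}^{m\times n}$ and $B=B_0+B_1\mathbf{i}+B_2\mathbf{j}+B_3\mathbf{k}\in\mathbb{Q}_{\mathbb{R}}^{m\times d}$ (components real matrices), and put $C=[A_0^T,A_1^T,A_2^T,A_3^T]^T\in\mathbb{R}^{4m\times n}$, $D=[B_0^T,B_1^T,B_2^T,B_3^T]^T\in\mathbb{R}^{4m\times d}$. Let $X\in\mathbb{R}^{n\times d}$ be a real matrix. Then $X$ is an RBTLS solution (for $A,B$) if and only if $X$ is a real TLS solution (for $C,D$). Moreover, let $X$ be a real TLS solution, and let $\widetilde E=[E_0^T,E_1^T,E_2^T,E_3^T]^T\in\mathbb{R}^{4m\times n}$ and $\widetilde G=[G_0^T,G_1^T,G_2^T,G_3^T]^T\in\mathbb{R}^{4m\times d}$ (with $E_t\in\mathbb{R}^{m\times n}$, $G_t\in\mathbb{R}^{m\times d}$) be such that $(C+\widetilde E)X=D+\widetilde G$ and $\|[\widetilde E,\widetilde G]\|_F$ equals the minimum value of the real TLS problem (such matrices exist). Set $\widehat E=E_0+E_1\mathbf{i}+E_2\mathbf{j}+E_3\mathbf{k}$ and $\widehat G=G_0+G_1\mathbf{i}+G_2\mathbf{j}+G_3\mathbf{k}$. Then $(A+\widehat E)X=B+\widehat G$ and $\|[\widehat E,\widehat G]\|_F$ equals the minimum value of the RBTLS problem, so that $X$ is an RBTLS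 solution with corresponding $\widehat E$ and $\widehat G$.
   Context: Reduced biquaternions: $\mathbb{Q}_{\mathbb{R}}$ is the commutative real algebra of elements $a=a_0+a_1\mathbf{i}+a_2\mathbf{j}+a_3\mathbf{k}$ ($a_t\in\mathbb{R}$) with $\mathbf{i}^2=\mathbf{k}^2=-1$, $\mathbf{j}^2=1$, $\mathbf{i}\mathbf{j}=\mathbf{j}\mathbf{i}=\mathbf{k}$, $\mathbf{j}\mathbf{k}=\mathbf{k}\mathbf{j}=\mathbf{i}$, $\mathbf{k}\mathbf{i}=\mathbf{i}\mathbf{k}=-\mathbf{j}$. The norm is $\|a\|=\sqrt{a_0^2+a_1^2+a_2^2+a_3^2}$, and for $M=(m_{ij})$ over $\mathbb{Q}_{\mathbb{R}}$, $\|M\|_F=\big(\sum_{i,j}\|m_{ij}\|^2\big)^{1/2}$. Real matrices are viewed as matrices over $\mathbb{Q}_{\mathbb{R}}$. RBTLS problem (unknown $X$ real): minimize $\|[\widehat E,\widehat G]\|_F$ over $X\in\mathbb{R}^{n\times d}$, $\widehat E\in\mathbb{Q}_{\mathbb{R}}^{m\times n}$, $\widehat G\in\mathbb{Q}_{\mathbb{R}}^{m\times d}$ subject to $(A+\widehat E)X=B+\widehat G$. An RBTLS solution is a real $X$ for which there are $\widehat E,\widehat G$ such that $(X,\widehat E,\widehat G)$ is feasible and attains the minimum. Real TLS problem: minimize $\|[\widetilde E,\widetilde G]\|_F$ over $X\in\mathbb{R}^{n\times d}$, $\widetilde E\in\mathbb{R}^{4m\times n}$, $\widetilde G\in\mathbb{R}^{4m\times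 d}$ subject to $(C+\widetilde E)X=D+\widetilde G$. A real TLS solution is an $X$ for which there are $\widetilde E,\widetilde G$ such that $(X,\widetilde E,\widetilde G)$ is feasible and attains the minimum. *)

theory Defs
  imports "HOL-Analysis.L2_Norm" "Jordan_Normal_Form.Matrix"
begin

section \<open>Reduced biquaternions\<close>

text \<open>
  \<open>RBQuat a\<^sub>0 a\<^sub>1 a\<^sub>2 a\<^sub>3\<close> is the number \<open>a\<^sub>0 + a\<^sub>1\<i> + a\<^sub>2\<j> + a\<^sub>3\<k>\<close>, where
  \<open>\<i>\<i> = \<k>\<k> = -1\<close>, \<open>\<j>\<j> = 1\<close>, \<open>\<i>\<j> = \<j>\<i> = \<k>\<close>, \<open>\<j>\<k> = \<k>\<j> = \<i>\<close> and \<open>\<k>\<i> = \<i>\<k> = -\<j>\<close>.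
\<close>

datatype rbquat = RBQuat (rb0: real) (rb1: real) (rb2: real) (rb3: real)

lemma rbquat_eq_iff:
  "a = b \<longleftrightarrow> rb0 a = rb0 b \<and> rb1 a = rb1 b \<and> rb2 a = rb2 b \<and> rb3 a = rb3 b"
  by (cases a; cases b) simp

instantiation rbquat :: comm_ring_1
begin

definition "0 = RBQuat 0 0 0 0"
definition "1 = RBQuat 1 0 0 0"
definition "a + b = RBQuat (rb0 a + rb0 b) (rb1 a + rb1 b) (rb2 a + rb2 b) (rb3 a + rb3 b)"
definition "- a = RBQuat (- rb0 a) (- rb1 a) (- rb2 a) (- rb3 a)"
definition "a - b = RBQuat (rb0 a - rb0 b) (rb1 a - rb1 b) (rb2 a - rb2 b) (rb3 a - rb3 b)"
definition "a * b = RBQuat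
  (rb0 a * rb0 b - rb1 a * rb1 b + rb2 a * rb2 b - rb3 a * rb3 b)
  (rb0 a * rb1 b + rb1 a * rb0 b + rb2 a * rb3 b + rb3 a * rb2 b)
  (rb0 a * rb2 b + rb2 a * rb0 b - rb1 a * rb3 b - rb3 a * rb1 b)
  (rb0 a * rb3 b + rb3 a * rb0 b + rb1 a * rb2 b + rb2 a * rb1 b)"

instance
  by standard
    (simp_all add: zero_rbquat_def one_rbquat_def plus_rbquat_def uminus_rbquat_def
      minus_rbquat_def times_rbquat_def rbquat_eq_iff algebra_simps)

end

instantiation rbquat :: real_algebra_1
begin

definition "r *\<^sub>R a = RBQuat (r * rb0 a) (r * rb1 a) (r * rb2 a) (r * rb3 a)"

instance
  by standard
    (simp_all add: scaleR_rbquat_def plus_rbquat_def times_rbquat_def rbquat_eq_iff algebra_simps)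

end

text \<open>
  The norm is Euclidean. It is not submultiplicative, so there is no instance of
  \<open>real_normed_algebra\<close>.
\<close>

instantiation rbquat :: real_normed_vector
begin

definition "norm a = sqrt ((rb0 a)\<^sup>2 + (rb1 a)\<^sup>2 + (rb2 a)\<^sup>2 + (rb3 a)\<^sup>2)"
definition "sgn (a :: rbquat) = a /\<^sub>R norm a"
definition "dist (a :: rbquat) b = norm (a - b)"
definition "(uniformity :: (rbquat \<times> rbquat) filter) =
  (INF e\<in>{0<..}. principal {(a, b). dist a b < e})"
definition "open (U :: rbquat set) \<longleftrightarrow>
  (\<forall>x\<in>U. eventually (\<lambda>(x', y). x' = x \<longrightarrow> y \<in> U) uniformity)"

instance
proof
  fix a b :: rbquat and r :: real and U :: "rbquat set"
  show "dist a b = norm (a - b)" by (rule dist_rbquat_def)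
  show "sgn a = a /\<^sub>R norm a" by (rule sgn_rbquat_def)
  show "uniformity = (INF e\<in>{0<..}. principal {(a :: rbquat, b). dist a b < e})"
    by (rule uniformity_rbquat_def)
  show "open U \<longleftrightarrow> (\<forall>x\<in>U. eventually (\<lambda>(x', y). x' = x \<longrightarrow> y \<in> U) uniformity)"
    by (rule open_rbquat_def)
  show "norm a = 0 \<longleftrightarrow> a = 0"
    by (simp add: norm_rbquat_def zero_rbquat_def rbquat_eq_iff add_nonneg_eq_0_iff)
  show "norm (r *\<^sub>R a) = \<bar>r\<bar> * norm a"
    by (simp add: norm_rbquat_def scaleR_rbquat_def power_mult_distrib real_sqrt_mult
        flip: distrib_left)
  let ?f = "\<lambda>(c :: rbquat) i. [rb0 c, rb1 c, rb2 c, rb3 c] ! i"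
  have norm_L2: "norm c = L2_set (?f c) {0..<4::nat}" for c
    by (simp add: norm_rbquat_def L2_set_def eval_nat_numeral)
  have "norm (a + b) = L2_set (\<lambda>i. ?f a i + ?f b i) {0..<4::nat}"
    by (simp add: norm_rbquat_def plus_rbquat_def L2_set_def eval_nat_numeral)
  then show "norm (a + b) \<le> norm a + norm b"
    unfolding norm_L2 by (simp add: L2_set_triangle_ineq)
qed

end

definition rb_i :: rbquat where "rb_i = RBQuat 0 1 0 0"
definition rb_j :: rbquat where "rb_j = RBQuat 0 0 1 0"
definition rb_k :: rbquat where "rb_k = RBQuat 0 0 0 1"

lemma rb_multiplication_table:
  "rb_i * rb_i = -1" "rb_j * rb_j = 1" "rb_k * rb_k = -1"
  "rb_i * rb_j = rb_k" "rb_j * rb_k = rb_i" "rb_k * rb_i = - rb_j"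
  by (simp_all add: rb_i_def rb_j_def rb_k_def times_rbquat_def one_rbquat_def uminus_rbquat_def)

lemma of_real_rbquat: "of_real r = RBQuat r 0 0 0"
  by (simp add: of_real_def scaleR_rbquat_def one_rbquat_def)

lemma RBQuat_eq_sum:
  "RBQuat a0 a1 a2 a3 = of_real a0 + of_real a1 * rb_i + of_real a2 * rb_j + of_real a3 * rb_k"
  by (simp add: of_real_rbquat rb_i_def rb_j_def rb_k_def times_rbquat_def plus_rbquat_def)

section \<open>Matrices\<close>

abbreviation real_to_rb_mat :: "real mat \<Rightarrow> rbquat mat" where
  "real_to_rb_mat M \<equiv> map_mat of_real M"

definition rb_mat :: "real mat \<Rightarrow> real mat \<Rightarrow> real mat \<Rightarrow> real mat \<Rightarrow> rbquat mat" where
  "rb_mat M0 M1 M2 M3 =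
     real_to_rb_mat M0 + rb_i \<cdot>\<^sub>m real_to_rb_mat M1
       + rb_j \<cdot>\<^sub>m real_to_rb_mat M2 + rb_k \<cdot>\<^sub>m real_to_rb_mat M3"

lemma rb_mat_decomposition:
  assumes "M \<in> carrier_mat p q"
  shows "M = rb_mat (map_mat rb0 M) (map_mat rb1 M) (map_mat rb2 M) (map_mat rb3 M)"
  using assms
  by (intro eq_matI)
    (auto simp: rb_mat_def of_real_rbquat rb_i_def rb_j_def rb_k_def times_rbquat_def
      plus_rbquat_def rbquat_eq_iff)

definition stack4 :: "'a :: zero mat \<Rightarrow> 'a mat \<Rightarrow> 'a mat \<Rightarrow> 'a mat \<Rightarrow> 'a mat" where
  "stack4 M0 M1 M2 M3 = M0 @\<^sub>r M1 @\<^sub>r M2 @\<^sub>r M3"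

definition append_cols :: "'a :: zero mat \<Rightarrow> 'a mat \<Rightarrow> 'a mat"  (infixr \<open>@\<^sub>c\<close> 65) where
  "M @\<^sub>c N = four_block_mat M N (0\<^sub>m 0 (dim_col M)) (0\<^sub>m 0 (dim_col N))"

definition frobenius_norm :: "'a :: real_normed_vector mat \<Rightarrow> real" where
  "frobenius_norm M = sqrt (\<Sum>i<dim_row M. \<Sum>j<dim_col M. (norm (M $$ (i, j)))\<^sup>2)"

section \<open>Total least squares problems\<close>

definition tls_objective :: "'x \<times> 'a :: real_normed_vector mat \<times> 'a mat \<Rightarrow> real" where
  "tls_objective = (\<lambda>(X, E, G). frobenius_norm (E @\<^sub>c G))"

definition tls_feasible ::
  "nat \<Rightarrow> nat \<Rightarrow> nat \<Rightarrow> real mat \<Rightarrow> real mat \<Rightarrow> real mat \<times> real mat \<times> real mat \<Rightarrow> bool" where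
  "tls_feasible p n d C D = (\<lambda>(X, E, G).
     X \<in> carrier_mat n d \<and> E \<in> carrier_mat p n \<and> G \<in> carrier_mat p d \<and> (C + E) * X = D + G)"

definition rbtls_feasible ::
  "nat \<Rightarrow> nat \<Rightarrow> nat \<Rightarrow> rbquat mat \<Rightarrow> rbquat mat \<Rightarrow> real mat \<times> rbquat mat \<times> rbquat mat \<Rightarrow> bool" where
  "rbtls_feasible m n d A B = (\<lambda>(X, E, G).
     X \<in> carrier_mat n d \<and> E \<in> carrier_mat m n \<and> G \<in> carrier_mat m d \<and>
     (A + E) * real_to_rb_mat X = B + G)"

definition tls_solution ::
  "nat \<Rightarrow> nat \<Rightarrow> nat \<Rightarrow> real mat \<Rightarrow> real mat \<Rightarrow> real mat \<Rightarrow> bool" where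
  "tls_solution p n d C D X \<longleftrightarrow>
     (\<exists>E G. is_arg_min tls_objective (tls_feasible p n d C D) (X, E, G))"

definition rbtls_solution ::
  "nat \<Rightarrow> nat \<Rightarrow> nat \<Rightarrow> rbquat mat \<Rightarrow> rbquat mat \<Rightarrow> real mat \<Rightarrow> bool" where
  "rbtls_solution m n d A B X \<longleftrightarrow>
     (\<exists>E G. is_arg_min tls_objective (rbtls_feasible m n d A B) (X, E, G))"

text \<open>
  A total least squares problem need not attain its infimum, hence the minimum value is a
  predicate on \<open>v\<close>, satisfied by no \<open>v\<close> when there is no minimum.
\<close>

definition is_minimum_value :: "('x \<Rightarrow> real) \<Rightarrow> ('x \<Rightarrow> bool) \<Rightarrow> real \<Rightarrow> bool" where
  "is_minimum_value f P v \<longleftrightarrow> (\<exists>x. is_arg_min f P x \<and> f x = v)"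

end

theory Submission
  imports Defs
begin

text \<open>
  Stacking the four real components of a reduced biquaternion matrix is an isometric linear
  bijection that commutes with right multiplication by real matrices and with juxtaposition of
  columns. It therefore identifies the feasible triples of both problems and their objectives.
\<close>

section \<open>The stacking map, its coordinates and its row indices\<close>

definition real_stack :: "rbquat mat \<Rightarrow> real mat" where
  "real_stack M = stack4 (map_mat rb0 M) (map_mat rb1 M) (map_mat rb2 M) (map_mat rb3 M)"

text \<open>Numbering the coordinates lets the four blocks be treated uniformly, with
  \<open>t\<close> as the block number. Beyond \<open>t < 4\<close> the list access is unspecified,
  hence the bound in the facts about it.\<close>

definition rb_component :: "nat \<Rightarrow> rbquat \<Rightarrow> real" where
  "rb_component t a = [rb0 a, rb1 a, rb2 a, rb3 a] ! t"

lemma less_4_cases: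
  fixes t :: nat
  assumes "t < 4"
  obtains "t = 0" | "t = 1" | "t = 2" | "t = 3"
  using assms by linarith

lemma rb_component_add:
  "t < 4 \<Longrightarrow> rb_component t (a + b) = rb_component t a + rb_component t b"
  by (erule less_4_cases) (simp_all add: rb_component_def plus_rbquat_def)

lemma rb_component_sum:
  assumes "t < 4"
  shows "rb_component t (\<Sum>i\<in>I. f i) = (\<Sum>i\<in>I. rb_component t (f i))"
proof -
  have "rb_component t 0 = 0"
    using assms by (rule less_4_cases) (simp_all add: rb_component_def zero_rbquat_def)
  then show ?thesis
    by (induction I rule: infinite_finite_induct) (simp_all add: rb_component_add[OF assms])
qed

text \<open>A real factor has no part along the other units, so the product does not mix
  coordinates. This is where the restriction to real \<open>X\<close> enters.\<close>

lemma rb_component_mult_of_real: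
  "t < 4 \<Longrightarrow> rb_component t (a * of_real r) = rb_component t a * r"
  by (erule less_4_cases) (simp_all add: rb_component_def times_rbquat_def of_real_rbquat)

lemma sum_rb_component_squares: "(\<Sum>t<4. (rb_component t a)\<^sup>2) = (norm a)\<^sup>2"
  by (simp add: rb_component_def norm_rbquat_def eval_nat_numeral)

lemma dim_real_stack [simp]:
  "dim_row (real_stack M) = 4 * dim_row M" "dim_col (real_stack M) = dim_col M"
  by (simp_all add: real_stack_def stack4_def append_rows_def)

lemma real_stack_carrier:
  "M \<in> carrier_mat m n \<Longrightarrow> real_stack M \<in> carrier_mat (4 * m) n"
  by (auto intro!: carrier_matI)

text \<open>The nested \<open>append_rows\<close> is resolved here for each of the four values of
  \<open>t\<close>. Later entrywise arguments about stacked matrices address rows as block number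
  times block height plus offset.\<close>

lemma real_stack_index:
  assumes "t < 4" "i < dim_row M" "j < dim_col M"
  shows "real_stack M $$ (t * dim_row M + i, j) = rb_component t (M $$ (i, j))"
  using assms(1) by (rule less_4_cases)
    (use assms(2,3) in \<open>auto simp: rb_component_def real_stack_def stack4_def append_rows_def\<close>)

text \<open>Quotient and remainder of \<open>k\<close> by \<open>m\<close> give the block and the
  row inside it; the assumption rules out \<open>m = 0\<close>.\<close>

lemma stacked_index_cases:
  fixes k m :: nat
  assumes "k < 4 * m"
  obtains t i where "t < 4" "i < m" "k = t * m + i"
proof
  show "k div m < 4" "k mod m < m" "k = k div m * m + k mod m"
    using assms by (cases "m = 0"; simp add: less_mult_imp_div_less)+
qed

lemma stacked_index_less:
  fixes t i m :: nat
  assumes "t < 4" "i < m"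
  shows "t * m + i < 4 * m"
  using assms by (elim less_4_cases) auto

text \<open>Every row number splits into block and offset, so it suffices to compare entries in the
  form that \<open>real_stack_index\<close> evaluates.\<close>

lemma stacked_eqI:
  assumes "N \<in> carrier_mat (4 * m) n" "N' \<in> carrier_mat (4 * m) n"
    and "\<And>t i j. t < 4 \<Longrightarrow> i < m \<Longrightarrow> j < n \<Longrightarrow> N $$ (t * m + i, j) = N' $$ (t * m + i, j)"
  shows "N = N'"
  by (rule eq_matI) (use assms in \<open>auto elim!: stacked_index_cases\<close>)

section \<open>Compatibility with sums, real right factors, columns and the norm\<close>

lemma real_stack_add:
  assumes "M \<in> carrier_mat m n" "N \<in> carrier_mat m n"
  shows "real_stack (M + N) = real_stack M + real_stack N"
proof (rule stacked_eqI)
  fix t i j :: nat assume "t < 4" "i < m" "j < n"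
  then show "real_stack (M + N) $$ (t * m + i, j) = (real_stack M + real_stack N) $$ (t * m + i, j)"
    using real_stack_index[of t i "M + N" j] real_stack_index[of t i M j]
      real_stack_index[of t i N j] assms
    by (simp add: rb_component_add stacked_index_less)
qed (use assms in \<open>auto intro!: carrier_matI\<close>)

text \<open>Each entry of the product is a sum of entries of \<open>M\<close> times real numbers,
  and taking a coordinate is additive and commutes with real factors.\<close>

lemma real_stack_mult_real:
  assumes M: "M \<in> carrier_mat m n" and X: "X \<in> carrier_mat n d"
  shows "real_stack (M * real_to_rb_mat X) = real_stack M * X"
proof (rule stacked_eqI)
  fix t i j :: nat assume *: "t < 4" "i < m" "j < d"
  then have "real_stack (M * real_to_rb_mat X) $$ (t * m + i, j)
      = rb_component t (\<Sum>l<n. M $$ (i, l) * of_real (X $$ (l, j)))"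
    using real_stack_index[of t i "M * real_to_rb_mat X" j] M X
    by (simp add: scalar_prod_def lessThan_atLeast0)
  also have "\<dots> = (\<Sum>l<n. real_stack M $$ (t * m + i, l) * X $$ (l, j))"
    using real_stack_index[of t i M] M *
    by (simp add: rb_component_sum rb_component_mult_of_real)
  also have "\<dots> = (real_stack M * X) $$ (t * m + i, j)"
    using M X * by (simp add: scalar_prod_def lessThan_atLeast0 stacked_index_less)
  finally show "real_stack (M * real_to_rb_mat X) $$ (t * m + i, j)
      = (real_stack M * X) $$ (t * m + i, j)" .
qed (use assms in \<open>auto intro!: carrier_matI\<close>)

lemma dim_append_cols [simp]:
  "dim_row (M @\<^sub>c N) = dim_row M" "dim_col (M @\<^sub>c N) = dim_col M + dim_col N"
  by (simp_all add: append_cols_def)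

lemma append_cols_index:
  assumes "i < dim_row M" "j < dim_col M + dim_col N"
  shows "(M @\<^sub>c N) $$ (i, j) = (if j < dim_col M then M $$ (i, j) else N $$ (i, j - dim_col M))"
  using assms by (simp add: append_cols_def)

text \<open>Stacking rearranges rows and leaves column indices alone. The objective is the norm of a
  juxtaposition, so this is needed to compare objectives.\<close>

lemma real_stack_append_cols:
  assumes "M \<in> carrier_mat m n" "N \<in> carrier_mat m d"
  shows "real_stack (M @\<^sub>c N) = real_stack M @\<^sub>c real_stack N"
proof (rule stacked_eqI)
  fix t i j :: nat assume "t < 4" "i < m" "j < n + d"
  then show "real_stack (M @\<^sub>c N) $$ (t * m + i, j)
      = (real_stack M @\<^sub>c real_stack N) $$ (t * m + i, j)"
    using real_stack_index[of t i "M @\<^sub>c N" j] real_stack_index[of t i M j]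
      \<comment> \<open>A column \<open>j\<close> with \<open>j \<ge> n\<close> belongs to the
        right-hand matrix, at offset \<open>j - n\<close>.\<close>
      real_stack_index[of t i N "j - n"] assms
    by (simp add: append_cols_index stacked_index_less)
qed (use assms in \<open>auto intro!: carrier_matI\<close>)

text \<open>The row sum splits into four blocks; once the sum over blocks is innermost, it collects
  the squared coordinates of one entry, which is the square of its norm.\<close>

lemma frobenius_norm_real_stack: "frobenius_norm (real_stack M) = frobenius_norm M"
proof -
  let ?m = "dim_row M" and ?n = "dim_col M"
  have blocks: "(\<Sum>k<4 * ?m. f k) = (\<Sum>t<4. \<Sum>i<?m. f (t * ?m + i))" for f :: "nat \<Rightarrow> real"
  proof -
    have "(\<Sum>k=t * ?m..<t * ?m + ?m. f k) = (\<Sum>i<?m. f (t * ?m + i))" for t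
      using sum.shift_bounds_nat_ivl[of f 0 "t * ?m" ?m] by (simp add: lessThan_atLeast0 add.commute)
    then show ?thesis
      using sum.nat_group[of f ?m 4] by simp
  qed
  have "(\<Sum>k<4 * ?m. \<Sum>j<?n. (norm (real_stack M $$ (k, j)))\<^sup>2)
      = (\<Sum>t<4. \<Sum>i<?m. \<Sum>j<?n. (norm (real_stack M $$ (t * ?m + i, j)))\<^sup>2)"
    by (rule blocks)
  also have "\<dots> = (\<Sum>t<4. \<Sum>i<?m. \<Sum>j<?n. (rb_component t (M $$ (i, j)))\<^sup>2)"
    by (simp add: real_stack_index)
  also have "\<dots> = (\<Sum>i<?m. \<Sum>j<?n. \<Sum>t<4. (rb_component t (M $$ (i, j)))\<^sup>2)"
    \<comment> \<open>The sum over \<open>t\<close> moves inwards in two exchanges, first past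
      \<open>i\<close> and then past \<open>j\<close>.\<close>
    by (subst sum.swap, rule sum.cong[OF refl], rule sum.swap)
  finally show ?thesis
    by (simp add: frobenius_norm_def sum_rb_component_squares)
qed

section \<open>Stacking as a bijection\<close>

lemma real_stack_inj:
  assumes "M \<in> carrier_mat m n" "N \<in> carrier_mat m n" "real_stack M = real_stack N"
  shows "M = N"
proof (rule eq_matI)
  fix i j assume "i < dim_row N" "j < dim_col N"
  then have "rb_component t (M $$ (i, j)) = rb_component t (N $$ (i, j))" if "t < 4" for t
    using real_stack_index[of t i M j] real_stack_index[of t i N j] assms that by simp
  from this[of 0] this[of 1] this[of 2] this[of 3] show "M $$ (i, j) = N $$ (i, j)"
    by (simp add: rb_component_def rbquat_eq_iff)
qed (use assms in auto)

text \<open>Ensures that every real correction comes from a reduced biquaternion one, so that no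
  real competitor escapes the comparison of the two problems.\<close>

lemma real_stack_surj:
  assumes "N \<in> carrier_mat (4 * m) n"
  obtains M where "M \<in> carrier_mat m n" "real_stack M = N"
proof
  \<comment> \<open>The four coordinates are read from row \<open>i\<close> of each block; the
    blocks start at rows \<open>0\<close>, \<open>m\<close>, \<open>2 * m\<close> and
    \<open>3 * m\<close>.\<close>
  let ?M = "mat m n (\<lambda>(i, j). RBQuat (N $$ (i, j)) (N $$ (m + i, j))
    (N $$ (2 * m + i, j)) (N $$ (3 * m + i, j)))"
  show M: "?M \<in> carrier_mat m n"
    by simp
  show "real_stack ?M = N"
  proof (rule stacked_eqI)
    fix t i j :: nat assume "t < 4" "i < m" "j < n"
    then show "real_stack ?M $$ (t * m + i, j) = N $$ (t * m + i, j)"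
      using real_stack_index[of t i ?M j]
      by (elim less_4_cases) (simp_all add: rb_component_def)
  qed (use assms M real_stack_carrier in auto)
qed

lemma rb_mat_carrier:
  assumes "M0 \<in> carrier_mat m n" "M1 \<in> carrier_mat m n" "M2 \<in> carrier_mat m n" "M3 \<in> carrier_mat m n"
  shows "rb_mat M0 M1 M2 M3 \<in> carrier_mat m n"
  using assms by (auto simp: rb_mat_def)

text \<open>The units place each real matrix in a coordinate of its own. This links the components
  named in the theorem to \<open>real_stack\<close>.\<close>

lemma real_stack_rb_mat:
  assumes "M0 \<in> carrier_mat m n" "M1 \<in> carrier_mat m n" "M2 \<in> carrier_mat m n" "M3 \<in> carrier_mat m n"
  shows "real_stack (rb_mat M0 M1 M2 M3) = stack4 M0 M1 M2 M3"
proof -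
  have "map_mat rb0 (rb_mat M0 M1 M2 M3) = M0" "map_mat rb1 (rb_mat M0 M1 M2 M3) = M1"
    "map_mat rb2 (rb_mat M0 M1 M2 M3) = M2" "map_mat rb3 (rb_mat M0 M1 M2 M3) = M3"
    using assms by (auto intro!: eq_matI simp: rb_mat_def of_real_rbquat rb_i_def rb_j_def rb_k_def
        times_rbquat_def plus_rbquat_def)
  then show ?thesis
    by (simp add: real_stack_def)
qed

section \<open>Transfer of feasibility and of minimizers\<close>

lemma tls_objective_real_stack:
  assumes "E \<in> carrier_mat m n" "G \<in> carrier_mat m d"
  shows "tls_objective (X, real_stack E, real_stack G) = tls_objective (X, E, G)"
  using assms by (simp add: tls_objective_def frobenius_norm_real_stack flip: real_stack_append_cols)

text \<open>Stacking both sides of one constraint yields the other, and injectivity allows the way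
  back. If \<open>X\<close> has the wrong dimensions, neither triple is feasible.\<close>

lemma tls_feasible_real_stack:
  assumes A: "A \<in> carrier_mat m n" and B: "B \<in> carrier_mat m d"
    and E: "E \<in> carrier_mat m n" and G: "G \<in> carrier_mat m d"
  shows "tls_feasible (4 * m) n d (real_stack A) (real_stack B) (X, real_stack E, real_stack G)
    \<longleftrightarrow> rbtls_feasible m n d A B (X, E, G)"
proof (cases "X \<in> carrier_mat n d")
  case True
  have "(real_stack A + real_stack E) * X = real_stack B + real_stack G
      \<longleftrightarrow> real_stack ((A + E) * real_to_rb_mat X) = real_stack (B + G)"
    using assms True by (simp add: real_stack_add[where m = m] real_stack_mult_real[where m = m and n = n])
  also have "\<dots> \<longleftrightarrow> (A + E) * real_to_rb_mat X = B + G"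
  proof -
    have "(A + E) * real_to_rb_mat X \<in> carrier_mat m d"
      using assms True by (intro mult_carrier_mat[where n = n]) auto
    then show ?thesis
      using B G real_stack_inj[of "(A + E) * real_to_rb_mat X" m d "B + G"] by auto
  qed
  finally show ?thesis
    using True E G by (simp add: tls_feasible_def rbtls_feasible_def real_stack_carrier)
qed (simp add: tls_feasible_def rbtls_feasible_def)

text \<open>Feasible triples with the same \<open>X\<close> correspond and have equal objectives. A
  competitor in one problem thus becomes a competitor of the same value in the other: by stacking in
  the first direction, by unstacking in the second.\<close>

lemma is_arg_min_real_stack:
  assumes A: "A \<in> carrier_mat m n" and B: "B \<in> carrier_mat m d"
    and E: "E \<in> carrier_mat m n" and G: "G \<in> carrier_mat m d"
  shows "is_arg_min tls_objective (tls_feasible (4 * m) n d (real_stack A) (real_stack B))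
      (X, real_stack E, real_stack G)
    \<longleftrightarrow> is_arg_min tls_objective (rbtls_feasible m n d A B) (X, E, G)" (is "?real \<longleftrightarrow> ?rb")
proof
  assume real: ?real
  have "\<not> tls_objective (Y, E', G') < tls_objective (X, E, G)"
    if "rbtls_feasible m n d A B (Y, E', G')" for Y E' G'
  proof -
    have "E' \<in> carrier_mat m n" "G' \<in> carrier_mat m d"
      using that by (auto simp: rbtls_feasible_def)
    then show ?thesis
      using real that E G tls_feasible_real_stack[OF A B] tls_objective_real_stack
      unfolding is_arg_min_def by metis
  qed
  then show ?rb
    using real tls_feasible_real_stack[OF assms] by (auto simp: is_arg_min_def)
next
  assume rb: ?rb
  have "\<not> tls_objective (Y, E', G') < tls_objective (X, real_stack E, real_stack G)"
    if feas: "tls_feasible (4 * m) n d (real_stack A) (real_stack B) (Y, E', G')" for Y E' G'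
  proof -
    have "E' \<in> carrier_mat (4 * m) n" "G' \<in> carrier_mat (4 * m) d"
      using feas by (auto simp: tls_feasible_def)
    \<comment> \<open>Surjectivity writes an arbitrary real competitor as a stacked one, to which
      the transfer of feasibility applies.\<close>
    then obtain E'' G'' where "E'' \<in> carrier_mat m n" "real_stack E'' = E'"
      "G'' \<in> carrier_mat m d" "real_stack G'' = G'"
      by (metis real_stack_surj)
    then show ?thesis
      using rb feas E G tls_feasible_real_stack[OF A B] tls_objective_real_stack
      unfolding is_arg_min_def by metis
  qed
  then show ?real
    using rb tls_feasible_real_stack[OF assms] by (auto simp: is_arg_min_def)
qed

lemma tls_solution_real_stack:
  assumes "A \<in> carrier_mat m n" "B \<in> carrier_mat m d"
  shows "tls_solution (4 * m) n d (real_stack A) (real_stack B) X \<longleftrightarrow> rbtls_solution m n d A B X"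
proof
  assume "tls_solution (4 * m) n d (real_stack A) (real_stack B) X"
  then obtain E' G' where min: "is_arg_min tls_objective
      (tls_feasible (4 * m) n d (real_stack A) (real_stack B)) (X, E', G')"
    by (auto simp: tls_solution_def)
  then have "E' \<in> carrier_mat (4 * m) n" "G' \<in> carrier_mat (4 * m) d"
    by (auto simp: is_arg_min_def tls_feasible_def)
  then obtain E G where "E \<in> carrier_mat m n" "real_stack E = E'"
    "G \<in> carrier_mat m d" "real_stack G = G'"
    by (metis real_stack_surj)
  then show "rbtls_solution m n d A B X"
    using min is_arg_min_real_stack[OF assms] unfolding rbtls_solution_def by metis
next
  assume "rbtls_solution m n d A B X"
  then obtain E G where min: "is_arg_min tls_objective (rbtls_feasible m n d A B) (X, E, G)"
    by (auto simp: rbtls_solution_def)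
  then have "E \<in> carrier_mat m n" "G \<in> carrier_mat m d"
    by (auto simp: is_arg_min_def rbtls_feasible_def)
  then show "tls_solution (4 * m) n d (real_stack A) (real_stack B) X"
    using min is_arg_min_real_stack[OF assms] unfolding tls_solution_def by metis
qed

text \<open>All minimizers share one value, so a feasible point that attains it is itself a
  minimizer. This translates between the minimum values in the theorem and
  \<open>is_arg_min\<close>.\<close>

lemma is_arg_min_iff_minimum_value:
  fixes f :: "'x \<Rightarrow> real"
  shows "is_arg_min f P x \<longleftrightarrow> P x \<and> is_minimum_value f P (f x)"
  unfolding is_minimum_value_def is_arg_min_def by metis

text \<open>Serves to split optimal real corrections into the four blocks over which the theorem
  quantifies.\<close>

lemma stack4_surj:
  fixes N :: "real mat"
  assumes "N \<in> carrier_mat (4 * m) n"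
  obtains M0 M1 M2 M3 where "{M0, M1, M2, M3} \<subseteq> carrier_mat m n" "stack4 M0 M1 M2 M3 = N"
proof -
  obtain M where "M \<in> carrier_mat m n" "real_stack M = N"
    using assms by (rule real_stack_surj)
  then show thesis
    by (intro that[of "map_mat rb0 M" "map_mat rb1 M" "map_mat rb2 M" "map_mat rb3 M"])
      (simp_all add: real_stack_def)
qed

section \<open>Equivalence of the two problems and recovery of the corrections\<close>

theorem corollary3p5:
  fixes m n d :: nat
    and A B :: "rbquat mat"
    and A0 A1 A2 A3 B0 B1 B2 B3 C D X :: "real mat"
  assumes "m \<ge> 1" "n \<ge> 1" "d \<ge> 1" "m > n" "m \<ge> n + d"
    and "A0 \<in> carrier_mat m n" "A1 \<in> carrier_mat m n" "A2 \<in> carrier_mat m n" "A3 \<in> carrier_mat m n"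
    and "B0 \<in> carrier_mat m d" "B1 \<in> carrier_mat m d" "B2 \<in> carrier_mat m d" "B3 \<in> carrier_mat m d"
    and "A = rb_mat A0 A1 A2 A3" "B = rb_mat B0 B1 B2 B3"
    and "C = stack4 A0 A1 A2 A3" "D = stack4 B0 B1 B2 B3"
    and "X \<in> carrier_mat n d"
  shows "(rbtls_solution m n d A B X \<longleftrightarrow> tls_solution (4 * m) n d C D X) \<and>
    (tls_solution (4 * m) n d C D X \<longrightarrow>
      (\<exists>E0 E1 E2 E3 G0 G1 G2 G3.
         {E0, E1, E2, E3} \<subseteq> carrier_mat m n \<and> {G0, G1, G2, G3} \<subseteq> carrier_mat m d \<and>
         (C + stack4 E0 E1 E2 E3) * X = D + stack4 G0 G1 G2 G3 \<and>
         is_minimum_value tls_objective (tls_feasible (4 * m) n d C D)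
           (frobenius_norm (stack4 E0 E1 E2 E3 @\<^sub>c stack4 G0 G1 G2 G3))) \<and>
      (\<forall>E0 E1 E2 E3 G0 G1 G2 G3.
         {E0, E1, E2, E3} \<subseteq> carrier_mat m n \<and> {G0, G1, G2, G3} \<subseteq> carrier_mat m d \<and>
         (C + stack4 E0 E1 E2 E3) * X = D + stack4 G0 G1 G2 G3 \<and>
         is_minimum_value tls_objective (tls_feasible (4 * m) n d C D)
           (frobenius_norm (stack4 E0 E1 E2 E3 @\<^sub>c stack4 G0 G1 G2 G3)) \<longrightarrow>
         (let Eh = rb_mat E0 E1 E2 E3; Gh = rb_mat G0 G1 G2 G3 in
            (A + Eh) * real_to_rb_mat X = B + Gh \<and>
            is_minimum_value tls_objective (rbtls_feasible m n d A B)
              (frobenius_norm (Eh @\<^sub>c Gh)) \<and>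
            is_arg_min tls_objective (rbtls_feasible m n d A B) (X, Eh, Gh))))"
proof -
  have A: "A \<in> carrier_mat m n" and B: "B \<in> carrier_mat m d"
    using assms by (simp_all add: rb_mat_carrier)
  have C: "C = real_stack A" and D: "D = real_stack B"
    using assms by (simp_all add: real_stack_rb_mat[where m = m])
  have exists: "\<exists>E0 E1 E2 E3 G0 G1 G2 G3.
      {E0, E1, E2, E3} \<subseteq> carrier_mat m n \<and> {G0, G1, G2, G3} \<subseteq> carrier_mat m d \<and>
      (C + stack4 E0 E1 E2 E3) * X = D + stack4 G0 G1 G2 G3 \<and>
      is_minimum_value tls_objective (tls_feasible (4 * m) n d C D)
        (frobenius_norm (stack4 E0 E1 E2 E3 @\<^sub>c stack4 G0 G1 G2 G3))"
    if sol: "tls_solution (4 * m) n d C D X"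
  proof -
    obtain E G where "is_arg_min tls_objective (tls_feasible (4 * m) n d C D) (X, E, G)"
      using sol by (auto simp: tls_solution_def)
    then have "E \<in> carrier_mat (4 * m) n" "G \<in> carrier_mat (4 * m) d" "(C + E) * X = D + G"
      "is_minimum_value tls_objective (tls_feasible (4 * m) n d C D) (frobenius_norm (E @\<^sub>c G))"
      by (auto simp: is_arg_min_iff_minimum_value tls_feasible_def tls_objective_def)
    then show ?thesis
      by (metis stack4_surj)
  qed
  have transfer: "let Eh = rb_mat E0 E1 E2 E3; Gh = rb_mat G0 G1 G2 G3 in
      (A + Eh) * real_to_rb_mat X = B + Gh \<and>
      is_minimum_value tls_objective (rbtls_feasible m n d A B) (frobenius_norm (Eh @\<^sub>c Gh)) \<and>
      is_arg_min tls_objective (rbtls_feasible m n d A B) (X, Eh, Gh)"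
    if E: "{E0, E1, E2, E3} \<subseteq> carrier_mat m n" and G: "{G0, G1, G2, G3} \<subseteq> carrier_mat m d"
      and eq: "(C + stack4 E0 E1 E2 E3) * X = D + stack4 G0 G1 G2 G3"
      and min: "is_minimum_value tls_objective (tls_feasible (4 * m) n d C D)
        (frobenius_norm (stack4 E0 E1 E2 E3 @\<^sub>c stack4 G0 G1 G2 G3))"
    for E0 E1 E2 E3 G0 G1 G2 G3
  proof -
    define Eh Gh where "Eh = rb_mat E0 E1 E2 E3" and "Gh = rb_mat G0 G1 G2 G3"
    have Eh: "Eh \<in> carrier_mat m n" "real_stack Eh = stack4 E0 E1 E2 E3"
      and Gh: "Gh \<in> carrier_mat m d" "real_stack Gh = stack4 G0 G1 G2 G3"
      using E G by (auto simp: Eh_def Gh_def intro!: rb_mat_carrier real_stack_rb_mat)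
    \<comment> \<open>The given blocks are the stacks of \<open>Eh\<close> and \<open>Gh\<close>.
      Being feasible with the minimum value, the stacked triple is a minimizer, which can then be
      unstacked.\<close>
    have "is_arg_min tls_objective (tls_feasible (4 * m) n d C D) (X, real_stack Eh, real_stack Gh)"
      using eq min Eh Gh \<open>X \<in> carrier_mat n d\<close> real_stack_carrier[OF Eh(1)] real_stack_carrier[OF Gh(1)]
      by (simp add: is_arg_min_iff_minimum_value tls_feasible_def tls_objective_def)
    then have "is_arg_min tls_objective (rbtls_feasible m n d A B) (X, Eh, Gh)"
      using is_arg_min_real_stack[OF A B Eh(1) Gh(1)] C D by simp
    moreover from this have "(A + Eh) * real_to_rb_mat X = B + Gh"
      "is_minimum_value tls_objective (rbtls_feasible m n d A B) (frobenius_norm (Eh @\<^sub>c Gh))"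
      by (auto simp: is_arg_min_iff_minimum_value rbtls_feasible_def tls_objective_def)
    ultimately show ?thesis
      by (simp add: Eh_def Gh_def)
  qed
  show ?thesis
    using tls_solution_real_stack[OF A B, of X] exists transfer C D by blast
qed

end
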